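(* Let $(M,g)$ be a finite-dimensional Riemannian manifold, let $H\in\mathcal{F}(M)$, let $\Omega$ be a skew-symmetric $(1,1)$ tensor field on $M$, and consider the ODE $\dot u=\Omega(u)\,\mathrm{grad}\,H(u)$ on $M$. Let $(\overline{\mathrm{grad}},\phi,c)$ be a discrete Riemannian gradient on $(M,g)$, and let $\overline{\Omega}\in\Gamma(c^*\mathcal{T}^1_1M)$ be a continuous skew-symmetric tensor field with $\overline{\Omega}(u,u)=\Omega(u)$ for all $u\in M$. Let $h>0$ be a step size and consider the (implicit) scheme $u^k\mapsto u^{k+1}$ given, with $c^k=c(u^k,u^{k+1})$, by $$u^{k+1}=\phi_{c^k}\bigl(W(u^k,u^{k+1})\bigr),\qquad W(u^k,u^{k+1})=\phi_{c^k}^{-1}(u^k)+h\,\overline{\Omega}(u^k,u^{k+1})\,\overline{\mathrm{grad}}H(u^k,u^{k+1}).$$ Then the scheme preserves $H$: whenever $u^k,u^{k+1}\in M$ satisfy these equations, $H(u^{k+1})=H(u^k)$.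
   Context: $\mathcal{F}(M)$ is the space of smooth real-valued functions on $M$; $\mathrm{grad}\,H$ is the Riemannian gradient, i.e. the unique vector field with $\langle \mathrm{d}H,\cdot\rangle=g(\mathrm{grad}\,H,\cdot)$. A $(1,1)$ tensor field $\Omega$ (a section of $\mathcal{T}^1_1M=TM\otimes T^*M$) assigns to each $u\in M$ a linear map $\Omega(u):T_uM\to T_uM$; skew-symmetric means $g(y,\Omega(u)y)=0$ for all $y\in T_uM$. Retraction: a smooth map $\phi:TM\to M$, with $\phi_p$ its restriction to $T_pM$ and $0_p$ the zero vector of $T_pM$, such that for every $p\in M$: (1) $\phi_p$ is defined in an open ball $B_{r_p}(0_p)\subset T_pM$ of radius $r_p$ about $0_p$; (2) $\phi_p(x)=p$ if and only if $x=0_p$; (3) the tangent map satisfies $T\phi_p|_{0_p}=\mathrm{Id}_{T_pM}$. Here $\phi_p^{-1}$ denotes the (local) inverse of $\phi_p$ near $0_p$; all points and tangent vectors are understood to lie where $\phi_p$ and $\phi_p^{-1}$ are mutually inverse. Discrete Riemannian gradient: a triple $(\overline{\mathrm{grad}},\phi,c)$ where (i) $c:M\times M\to M$ is continuous with $c(u,u)=u$ for all $u\in M$; (ii) $\overline{\mathrm{grad}}:\mathcal{F}(M)\to\Gamma(c^*TM)$ assigns to each $H$ a continuous section of the pullback bundle $c^*TM$, i.e. $\overline{\mathrm{grad}}H(u,v)\in T_{c(u,v)}M$; (iii) $\phi$ is a retraction; such that for all $H\in\mathcal{F}(M)$ and $u,v\in M$, with $c=c(u,v)$, $$H(v)-H(u)=g\bigl(\overline{\mathrm{grad}}H(u,v),\,\phi_c^{-1}(v)-\phi_c^{-1}(u)\bigr),\qquad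 \overline{\mathrm{grad}}H(u,u)=\mathrm{grad}\,H(u).$$ $\overline{\Omega}\in\Gamma(c^*\mathcal{T}^1_1M)$ means that $\overline{\Omega}(u,v):T_{c(u,v)}M\to T_{c(u,v)}M$ is linear for all $u,v\in M$; skew-symmetric means $g(y,\overline{\Omega}(u,v)y)=0$ for all $y\in T_{c(u,v)}M$. *)

theory Defs
  imports "HOL-Analysis.Analysis" "HOL-Library.Function_Algebras"
begin

instantiation "fun" :: (type, real_vector) real_vector
begin

definition scaleR_fun :: "real \<Rightarrow> ('a \<Rightarrow> 'b) \<Rightarrow> 'a \<Rightarrow> 'b" where
  "scaleR_fun r f = (\<lambda>x. r *\<^sub>R f x)"

instance
  by standard (auto simp: scaleR_fun_def fun_eq_iff scaleR_add_right scaleR_add_left)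

end


section \<open>Smooth manifolds\<close>

fun Ck_on :: "nat \<Rightarrow> 'e::real_normed_vector set \<Rightarrow> ('e \<Rightarrow> 'f::real_normed_vector) \<Rightarrow> bool" where
  "Ck_on 0 S f \<longleftrightarrow> continuous_on S f"
| "Ck_on (Suc k) S f \<longleftrightarrow>
     (\<forall>x\<in>S. f differentiable at x) \<and> (\<forall>v. Ck_on k S (\<lambda>x. frechet_derivative f (at x) v))"

text \<open>Only meaningful for an open subset \<open>S\<close> of a finite-dimensional space, where continuity of all
  directional derivatives is the same as continuity of the derivative in the operator norm.\<close>

definition smooth_on :: "'e::real_normed_vector set \<Rightarrow> ('e \<Rightarrow> 'f::real_normed_vector) \<Rightarrow> bool" where
  "smooth_on S f \<longleftrightarrow> (\<forall>k. Ck_on k S f)"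

datatype ('a, 'e) chart = Chart (chart_dom: "'a set") (chart_map: "'a \<Rightarrow> 'e")

definition chart_image :: "('a, 'e) chart \<Rightarrow> 'e set" where
  "chart_image \<kappa> = chart_map \<kappa> ` chart_dom \<kappa>"

definition chart_inv :: "('a, 'e) chart \<Rightarrow> 'e \<Rightarrow> 'a" where
  "chart_inv \<kappa> = inv_into (chart_dom \<kappa>) (chart_map \<kappa>)"

definition transition :: "('a, 'e) chart \<Rightarrow> ('a, 'e) chart \<Rightarrow> 'e \<Rightarrow> 'e" where
  "transition \<kappa> \<kappa>' = chart_map \<kappa>' \<circ> chart_inv \<kappa>"

record ('a, 'e) manifold =
  Top :: "'a topology"
  Atlas :: "('a, 'e) chart set"

abbreviation points :: "('a, 'e) manifold \<Rightarrow> 'a set" where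
  "points M \<equiv> topspace (Top M)"

definition second_countable :: "'a topology \<Rightarrow> bool" where
  "second_countable X \<longleftrightarrow>
     (\<exists>\<B>. countable \<B> \<and> (\<forall>B\<in>\<B>. openin X B) \<and>
          (\<forall>U x. openin X U \<and> x \<in> U \<longrightarrow> (\<exists>B\<in>\<B>. x \<in> B \<and> B \<subseteq> U)))"

text \<open>The model space is an arbitrary finite-dimensional real normed space rather than a
  \<open>euclidean_space\<close>, because the latter class excludes dimension \<open>0\<close>.\<close>

definition smooth_manifold :: "('a, 'e::real_normed_vector) manifold \<Rightarrow> bool" where
  "smooth_manifold M \<longleftrightarrow>
     (\<exists>B::'e set. finite B \<and> span B = UNIV) \<and>
     Hausdorff_space (Top M) \<and> second_countable (Top M) \<and>
     (\<Union>\<kappa>\<in>Atlas M. chart_dom \<kappa>) = points M \<and>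
     (\<forall>\<kappa>\<in>Atlas M. openin (Top M) (chart_dom \<kappa>) \<and> open (chart_image \<kappa>) \<and>
        homeomorphic_map (subtopology (Top M) (chart_dom \<kappa>)) (top_of_set (chart_image \<kappa>))
          (chart_map \<kappa>)) \<and>
     (\<forall>\<kappa>\<in>Atlas M. \<forall>\<kappa>'\<in>Atlas M.
        smooth_on (chart_map \<kappa> ` (chart_dom \<kappa> \<inter> chart_dom \<kappa>')) (transition \<kappa> \<kappa>'))"

definition smooth_map_on ::
  "('a, 'e::real_normed_vector) manifold \<Rightarrow> ('b, 'f::real_normed_vector) manifold \<Rightarrow>
   'a set \<Rightarrow> ('a \<Rightarrow> 'b) \<Rightarrow> bool" where
  "smooth_map_on M N D f \<longleftrightarrow>
     openin (Top M) D \<and> continuous_map (subtopology (Top M) D) (Top N) f \<and>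
     (\<forall>\<kappa>\<in>Atlas M. \<forall>\<kappa>'\<in>Atlas N.
        smooth_on (chart_map \<kappa> ` {p \<in> D \<inter> chart_dom \<kappa>. f p \<in> chart_dom \<kappa>'})
          (chart_map \<kappa>' \<circ> f \<circ> chart_inv \<kappa>))"

definition real_line :: "(real, real) manifold" where
  "real_line = \<lparr>Top = euclidean, Atlas = {Chart UNIV id}\<rparr>"

definition smooth_functions :: "('a, 'e::real_normed_vector) manifold \<Rightarrow> ('a \<Rightarrow> real) set" where
  "smooth_functions M = {H. smooth_map_on M real_line (points M) H}"


section \<open>Tangent spaces and the tangent bundle\<close>

text \<open>A tangent vector at \<open>p\<close> is the family of its coordinate representatives, one for each chart
  around \<open>p\<close>, related by the derivatives of the transition maps (and \<open>0\<close> at all other charts).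
  The vector space operations are pointwise. The base point is not part of the
  vector, so elements of the tangent bundle are pairs \<open>(p, X)\<close>.\<close>

type_synonym ('a, 'e) tangent = "('a, 'e) chart \<Rightarrow> 'e"

definition tangent_space ::
  "('a, 'e::real_normed_vector) manifold \<Rightarrow> 'a \<Rightarrow> ('a, 'e) tangent set" where
  "tangent_space M p =
     {X. (\<forall>\<kappa>\<in>Atlas M. \<forall>\<kappa>'\<in>Atlas M. p \<in> chart_dom \<kappa> \<inter> chart_dom \<kappa>' \<longrightarrow>
            X \<kappa>' = frechet_derivative (transition \<kappa> \<kappa>') (at (chart_map \<kappa> p)) (X \<kappa>)) \<and>
         (\<forall>\<kappa>. \<not> (\<kappa> \<in> Atlas M \<and> p \<in> chart_dom \<kappa>) \<longrightarrow> X \<kappa> = 0)}"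

definition coord_vector ::
  "('a, 'e::real_normed_vector) manifold \<Rightarrow> ('a, 'e) chart \<Rightarrow> 'a \<Rightarrow> 'e \<Rightarrow> ('a, 'e) tangent" where
  "coord_vector M \<kappa> p v = (THE X. X \<in> tangent_space M p \<and> X \<kappa> = v)"

definition tangent_chart ::
  "('a, 'e::real_normed_vector) manifold \<Rightarrow> ('a, 'e) chart \<Rightarrow>
   ('a \<times> ('a, 'e) tangent, 'e \<times> 'e) chart" where
  "tangent_chart M \<kappa> =
     Chart (Sigma (chart_dom \<kappa>) (tangent_space M)) (\<lambda>(p, X). (chart_map \<kappa> p, X \<kappa>))"

definition tangent_bundle ::
  "('a, 'e::real_normed_vector) manifold \<Rightarrow> ('a \<times> ('a, 'e) tangent, 'e \<times> 'e) manifold" where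
  "tangent_bundle M =
     \<lparr>Top = topology_generated_by
        {{z \<in> chart_dom (tangent_chart M \<kappa>). chart_map (tangent_chart M \<kappa>) z \<in> U} | \<kappa> U.
           \<kappa> \<in> Atlas M \<and> open U},
      Atlas = tangent_chart M ` Atlas M\<rparr>"

text \<open>The differential \<open>\<langle>dH, X\<rangle>\<close>, computed in any chart around \<open>p\<close>.\<close>

definition differential ::
  "('a, 'e::real_normed_vector) manifold \<Rightarrow> ('a \<Rightarrow> real) \<Rightarrow> 'a \<Rightarrow> ('a, 'e) tangent \<Rightarrow> real" where
  "differential M H p X =
     (THE d. \<forall>\<kappa>\<in>Atlas M. p \<in> chart_dom \<kappa> \<longrightarrow>
        d = frechet_derivative (H \<circ> chart_inv \<kappa>) (at (chart_map \<kappa> p)) (X \<kappa>))"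

definition tangent_endo ::
  "('a, 'e::real_normed_vector) manifold \<Rightarrow> 'a \<Rightarrow> (('a, 'e) tangent \<Rightarrow> ('a, 'e) tangent) \<Rightarrow> bool"
where
  "tangent_endo M p L \<longleftrightarrow>
     (\<forall>X\<in>tangent_space M p. L X \<in> tangent_space M p) \<and>
     (\<forall>X\<in>tangent_space M p. \<forall>Y\<in>tangent_space M p. L (X + Y) = L X + L Y) \<and>
     (\<forall>r. \<forall>X\<in>tangent_space M p. L (r *\<^sub>R X) = r *\<^sub>R L X)"


section \<open>Riemannian metrics\<close>

type_synonym ('a, 'e) metric_tensor =
  "'a \<Rightarrow> ('a, 'e) tangent \<Rightarrow> ('a, 'e) tangent \<Rightarrow> real"

definition riemannian_metric ::
  "('a, 'e::real_normed_vector) manifold \<Rightarrow> ('a, 'e) metric_tensor \<Rightarrow> bool" where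
  "riemannian_metric M g \<longleftrightarrow>
     (\<forall>p\<in>points M. \<forall>X\<in>tangent_space M p. \<forall>Y\<in>tangent_space M p.
        (\<forall>Z\<in>tangent_space M p. g p (X + Y) Z = g p X Z + g p Y Z) \<and>
        (\<forall>r. g p (r *\<^sub>R X) Y = r * g p X Y) \<and>
        g p X Y = g p Y X \<and>
        (X \<noteq> 0 \<longrightarrow> 0 < g p X X)) \<and>
     (\<forall>\<kappa>\<in>Atlas M. \<forall>v w.
        smooth_on (chart_image \<kappa>)
          (\<lambda>y. let p = chart_inv \<kappa> y in g p (coord_vector M \<kappa> p v) (coord_vector M \<kappa> p w)))"

definition riemannian_manifold ::
  "('a, 'e::real_normed_vector) manifold \<Rightarrow> ('a, 'e) metric_tensor \<Rightarrow> bool" where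
  "riemannian_manifold M g \<longleftrightarrow> smooth_manifold M \<and> riemannian_metric M g"

definition riem_grad ::
  "('a, 'e::real_normed_vector) manifold \<Rightarrow> ('a, 'e) metric_tensor \<Rightarrow>
   ('a \<Rightarrow> real) \<Rightarrow> 'a \<Rightarrow> ('a, 'e) tangent" where
  "riem_grad M g H p =
     (THE Y. Y \<in> tangent_space M p \<and>
        (\<forall>X\<in>tangent_space M p. differential M H p X = g p Y X))"

definition tangent_ball ::
  "('a, 'e::real_normed_vector) manifold \<Rightarrow> ('a, 'e) metric_tensor \<Rightarrow>
   'a \<Rightarrow> real \<Rightarrow> ('a, 'e) tangent set" where
  "tangent_ball M g p r = {X \<in> tangent_space M p. sqrt (g p X X) < r}"

definition skew_symmetric_at ::
  "('a, 'e::real_normed_vector) manifold \<Rightarrow> ('a, 'e) metric_tensor \<Rightarrow> 'a \<Rightarrow>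
   (('a, 'e) tangent \<Rightarrow> ('a, 'e) tangent) \<Rightarrow> bool" where
  "skew_symmetric_at M g p L \<longleftrightarrow> (\<forall>y\<in>tangent_space M p. g p y (L y) = 0)"

definition skew_tensor_field ::
  "('a, 'e::real_normed_vector) manifold \<Rightarrow> ('a, 'e) metric_tensor \<Rightarrow>
   ('a \<Rightarrow> ('a, 'e) tangent \<Rightarrow> ('a, 'e) tangent) \<Rightarrow> bool" where
  "skew_tensor_field M g \<Omega> \<longleftrightarrow>
     (\<forall>u\<in>points M. tangent_endo M u (\<Omega> u) \<and> skew_symmetric_at M g u (\<Omega> u))"


section \<open>Retractions\<close>

text \<open>A retraction need not be defined on all of the tangent bundle: \<open>D\<close> is its (open) domain,
  which contains a ball around the origin of every tangent space. The last condition is the equation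
  \<open>T\<phi>\<^sub>p = Id\<close> at \<open>0\<^sub>p\<close>, read in a chart \<open>\<kappa>\<close> around \<open>p\<close> of the manifold and in
  the induced linear chart of \<open>T\<^sub>pM\<close>, with \<open>T(T\<^sub>pM)\<close> at \<open>0\<^sub>p\<close> identified with \<open>T\<^sub>pM\<close>.\<close>

definition manifold_retraction ::
  "('a, 'e::real_normed_vector) manifold \<Rightarrow> ('a, 'e) metric_tensor \<Rightarrow>
   ('a \<times> ('a, 'e) tangent) set \<Rightarrow> ('a \<Rightarrow> ('a, 'e) tangent \<Rightarrow> 'a) \<Rightarrow> bool" where
  "manifold_retraction M g D \<phi> \<longleftrightarrow>
     smooth_map_on (tangent_bundle M) M D (\<lambda>(p, X). \<phi> p X) \<and>
     (\<forall>p\<in>points M. \<exists>r>0. {p} \<times> tangent_ball M g p r \<subseteq> D) \<and>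
     (\<forall>(p, X)\<in>D. \<phi> p X = p \<longleftrightarrow> X = 0) \<and>
     (\<forall>p\<in>points M. \<forall>\<kappa>\<in>Atlas M. p \<in> chart_dom \<kappa> \<longrightarrow>
        ((\<lambda>v. chart_map \<kappa> (\<phi> p (coord_vector M \<kappa> p v))) has_derivative (\<lambda>v. v)) (at 0))"

text \<open>\<open>V p\<close> is the neighbourhood of \<open>0\<^sub>p\<close> on which \<open>\<phi> p\<close> is inverted; \<open>\<phi> p\<close> and
  \<open>retr_inv \<phi> V p\<close> are mutually inverse bijections between \<open>V p\<close> and \<open>\<phi> p ` V p\<close>.\<close>

definition inverse_domain ::
  "('a, 'e::real_normed_vector) manifold \<Rightarrow> ('a \<times> ('a, 'e) tangent) set \<Rightarrow>
   ('a \<Rightarrow> ('a, 'e) tangent \<Rightarrow> 'a) \<Rightarrow> ('a \<Rightarrow> ('a, 'e) tangent set) \<Rightarrow> bool" where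
  "inverse_domain M D \<phi> V \<longleftrightarrow>
     (\<forall>p\<in>points M. 0 \<in> V p \<and> {p} \<times> V p \<subseteq> D \<and> inj_on (\<phi> p) (V p) \<and>
        openin (subtopology (Top (tangent_bundle M)) ({p} \<times> tangent_space M p)) ({p} \<times> V p))"

definition retr_inv ::
  "('a \<Rightarrow> ('a, 'e) tangent \<Rightarrow> 'a) \<Rightarrow> ('a \<Rightarrow> ('a, 'e) tangent set) \<Rightarrow>
   'a \<Rightarrow> 'a \<Rightarrow> ('a, 'e) tangent" where
  "retr_inv \<phi> V p = inv_into (V p) (\<phi> p)"


section \<open>Discrete Riemannian gradients and the discrete gradient scheme\<close>

text \<open>A section \<open>s\<close> of the pullback bundle \<open>c\<^sup>*TM\<close> is continuous iff \<open>(u, v) \<mapsto> (c(u, v), s(u, v))\<close> is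
  continuous into \<open>TM\<close>. Since \<open>\<phi>\<^sub>c\<close> is only locally invertible, the mean value identity is
  imposed on those \<open>u\<close>, \<open>v\<close> for which both inverse images exist.\<close>

definition discrete_riemannian_gradient ::
  "('a, 'e::real_normed_vector) manifold \<Rightarrow> ('a, 'e) metric_tensor \<Rightarrow>
   (('a \<Rightarrow> real) \<Rightarrow> 'a \<Rightarrow> 'a \<Rightarrow> ('a, 'e) tangent) \<Rightarrow>
   ('a \<times> ('a, 'e) tangent) set \<Rightarrow> ('a \<Rightarrow> ('a, 'e) tangent \<Rightarrow> 'a) \<Rightarrow>
   ('a \<Rightarrow> ('a, 'e) tangent set) \<Rightarrow> ('a \<Rightarrow> 'a \<Rightarrow> 'a) \<Rightarrow> bool" where
  "discrete_riemannian_gradient M g dgrad D \<phi> V c \<longleftrightarrow>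
     continuous_map (prod_topology (Top M) (Top M)) (Top M) (\<lambda>(u, v). c u v) \<and>
     (\<forall>u\<in>points M. c u u = u) \<and>
     manifold_retraction M g D \<phi> \<and> inverse_domain M D \<phi> V \<and>
     (\<forall>H\<in>smooth_functions M.
        (\<forall>u\<in>points M. \<forall>v\<in>points M. dgrad H u v \<in> tangent_space M (c u v)) \<and>
        continuous_map (prod_topology (Top M) (Top M)) (Top (tangent_bundle M))
          (\<lambda>(u, v). (c u v, dgrad H u v)) \<and>
        (\<forall>u\<in>points M. \<forall>v\<in>points M. let p = c u v in
           u \<in> \<phi> p ` V p \<and> v \<in> \<phi> p ` V p \<longrightarrow>
           H v - H u = g p (dgrad H u v) (retr_inv \<phi> V p v - retr_inv \<phi> V p u)) \<and>
        (\<forall>u\<in>points M. dgrad H u u = riem_grad M g H u))"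

text \<open>A continuous section of \<open>c\<^sup>*T\<^sup>1\<^sub>1M\<close>; continuity is that of the matrix coefficients in the
  charts of \<open>M\<close>.\<close>

definition continuous_pullback_tensor ::
  "('a, 'e::real_normed_vector) manifold \<Rightarrow> ('a \<Rightarrow> 'a \<Rightarrow> 'a) \<Rightarrow>
   ('a \<Rightarrow> 'a \<Rightarrow> ('a, 'e) tangent \<Rightarrow> ('a, 'e) tangent) \<Rightarrow> bool" where
  "continuous_pullback_tensor M c \<Omega>b \<longleftrightarrow>
     (\<forall>u\<in>points M. \<forall>v\<in>points M. tangent_endo M (c u v) (\<Omega>b u v)) \<and>
     (\<forall>\<kappa>\<in>Atlas M. \<forall>w.
        continuous_map
          (subtopology (prod_topology (Top M) (Top M)) {(u, v). c u v \<in> chart_dom \<kappa>}) euclidean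
          (\<lambda>(u, v). \<Omega>b u v (coord_vector M \<kappa> (c u v) w) \<kappa>))"

text \<open>\<open>u1\<close> is a solution of the implicit scheme with data \<open>u0\<close>; the two membership conditions say
  that \<open>\<phi>\<^sub>c\<close> and its local inverse are only evaluated where they are mutually inverse.\<close>

definition discrete_gradient_step ::
  "('a \<Rightarrow> ('a, 'e::real_normed_vector) tangent \<Rightarrow> 'a) \<Rightarrow> ('a \<Rightarrow> ('a, 'e) tangent set) \<Rightarrow>
   ('a \<Rightarrow> 'a \<Rightarrow> 'a) \<Rightarrow> (('a \<Rightarrow> real) \<Rightarrow> 'a \<Rightarrow> 'a \<Rightarrow> ('a, 'e) tangent) \<Rightarrow>
   ('a \<Rightarrow> 'a \<Rightarrow> ('a, 'e) tangent \<Rightarrow> ('a, 'e) tangent) \<Rightarrow>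
   ('a \<Rightarrow> real) \<Rightarrow> real \<Rightarrow> 'a \<Rightarrow> 'a \<Rightarrow> bool" where
  "discrete_gradient_step \<phi> V c dgrad \<Omega>b H h u0 u1 \<longleftrightarrow>
     (let p = c u0 u1;
          W = retr_inv \<phi> V p u0 + h *\<^sub>R \<Omega>b u0 u1 (dgrad H u0 u1)
      in u0 \<in> \<phi> p ` V p \<and> W \<in> V p \<and> u1 = \<phi> p W)"

end

theory Submission
  imports Defs
begin

text \<open>Lift both points to the tangent space at p = c(u0, u1) by the local inverse of the
  retraction. The scheme says that the lifts differ by h L G, where G is the discrete gradient and L
  the value of \<open>\<Omega>b\<close> at (u0, u1). The mean value identity then turns the change
  of H into g(G, h L G) = h g(G, L G), which vanishes by skew-symmetry of L. The one auxiliary fact,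
  \<open>tangent_space_scaleR\<close>, keeps h L G in the tangent space, where the laws of the
  metric hold.\<close>

text \<open>Representatives in two charts are related by the derivative of a transition map; this
  derivative is linear, so scaling all representatives at once keeps them compatible.\<close>

lemma tangent_space_scaleR:
  fixes M :: "('a, 'e::real_normed_vector) manifold"
  assumes M: "smooth_manifold M" and X: "X \<in> tangent_space M p"
  shows "r *\<^sub>R X \<in> tangent_space M p"
  unfolding tangent_space_def
proof (intro CollectI conjI ballI allI impI)
  fix \<kappa> \<kappa>'
  assume \<kappa>: "\<kappa> \<in> Atlas M" "\<kappa>' \<in> Atlas M" "p \<in> chart_dom \<kappa> \<inter> chart_dom \<kappa>'"
  let ?D = "frechet_derivative (transition \<kappa> \<kappa>') (at (chart_map \<kappa> p))"
  have "smooth_on (chart_map \<kappa> ` (chart_dom \<kappa> \<inter> chart_dom \<kappa>')) (transition \<kappa> \<kappa>')"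
    using M \<kappa> unfolding smooth_manifold_def by blast
  \<comment> \<open>Order one is what yields differentiability on the overlap; without it
    \<open>frechet_derivative\<close> is an arbitrary choice that need not be linear.\<close>
  then have "Ck_on (Suc 0) (chart_map \<kappa> ` (chart_dom \<kappa> \<inter> chart_dom \<kappa>')) (transition \<kappa> \<kappa>')"
    unfolding smooth_on_def by blast
  then have "transition \<kappa> \<kappa>' differentiable at (chart_map \<kappa> p)"
    using \<kappa>(3) by simp
  then have "linear ?D"
    by (rule linear_frechet_derivative)
  moreover have "X \<kappa>' = ?D (X \<kappa>)"
    using X \<kappa> unfolding tangent_space_def by blast
  ultimately show "(r *\<^sub>R X) \<kappa>' = ?D ((r *\<^sub>R X) \<kappa>)"
    by (simp add: scaleR_fun_def linear_cmul)
next
  fix \<kappa>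
  assume "\<not> (\<kappa> \<in> Atlas M \<and> p \<in> chart_dom \<kappa>)"
  then show "(r *\<^sub>R X) \<kappa> = 0"
    using X by (simp add: tangent_space_def scaleR_fun_def)
qed

theorem mainTheorem1:
  fixes M :: "('a, 'e::real_normed_vector) manifold"
    and g :: "('a, 'e) metric_tensor"
    and H :: "'a \<Rightarrow> real"
    and \<Omega> :: "'a \<Rightarrow> ('a, 'e) tangent \<Rightarrow> ('a, 'e) tangent"
    and dgrad :: "('a \<Rightarrow> real) \<Rightarrow> 'a \<Rightarrow> 'a \<Rightarrow> ('a, 'e) tangent"
    and D :: "('a \<times> ('a, 'e) tangent) set"
    and \<phi> :: "'a \<Rightarrow> ('a, 'e) tangent \<Rightarrow> 'a"
    and V :: "'a \<Rightarrow> ('a, 'e) tangent set"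
    and c :: "'a \<Rightarrow> 'a \<Rightarrow> 'a"
    and \<Omega>b :: "'a \<Rightarrow> 'a \<Rightarrow> ('a, 'e) tangent \<Rightarrow> ('a, 'e) tangent"
    and h :: real
    and u0 u1 :: 'a
  assumes "riemannian_manifold M g"
    and "H \<in> smooth_functions M"
    and "skew_tensor_field M g \<Omega>"
    and "discrete_riemannian_gradient M g dgrad D \<phi> V c"
    and "continuous_pullback_tensor M c \<Omega>b"
    and "\<And>u v. u \<in> points M \<Longrightarrow> v \<in> points M \<Longrightarrow> skew_symmetric_at M g (c u v) (\<Omega>b u v)"
    and "\<And>u y. u \<in> points M \<Longrightarrow> y \<in> tangent_space M u \<Longrightarrow> \<Omega>b u u y = \<Omega> u y"
    and "h > 0"
    and "u0 \<in> points M" and "u1 \<in> points M"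
    and "discrete_gradient_step \<phi> V c dgrad \<Omega>b H h u0 u1"
  shows "H u1 = H u0"
proof -
  define p where "p = c u0 u1"
  define G where "G = dgrad H u0 u1"
  define L where "L = \<Omega>b u0 u1"
  define W where "W = retr_inv \<phi> V p u0 + h *\<^sub>R L G"
  have step: "u0 \<in> \<phi> p ` V p" "W \<in> V p" "u1 = \<phi> p W"
    using assms(11) unfolding discrete_gradient_step_def W_def p_def G_def L_def Let_def by auto
  have c: "continuous_map (prod_topology (Top M) (Top M)) (Top M) (\<lambda>(u, v). c u v)"
    and V: "inverse_domain M D \<phi> V"
    using assms(4) unfolding discrete_riemannian_gradient_def by blast+
  have G: "G \<in> tangent_space M p"
    and mean_value: "u0 \<in> \<phi> p ` V p \<and> u1 \<in> \<phi> p ` V p \<longrightarrow>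
      H u1 - H u0 = g p G (retr_inv \<phi> V p u1 - retr_inv \<phi> V p u0)"
    using assms(2,4,9,10)
    unfolding discrete_riemannian_gradient_def Let_def G_def p_def by blast+
  have p: "p \<in> points M"
    using continuous_map_image_subset_topspace[OF c] assms(9,10) unfolding p_def by auto
  have "inj_on (\<phi> p) (V p)"
    using V p unfolding inverse_domain_def by blast
  \<comment> \<open>Since \<open>W\<close> lies in \<open>V p\<close>, where \<open>\<phi> p\<close>
    is injective, the local inverse recovers exactly \<open>W\<close> from \<open>u1\<close>, and
    the lift of \<open>u0\<close> cancels in the difference.\<close>
  then have "retr_inv \<phi> V p u1 = W"
    using step unfolding retr_inv_def by (simp add: inv_into_f_f)
  then have "H u1 - H u0 = g p G (h *\<^sub>R L G)"
    using mean_value step by (simp add: W_def)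
  also have "\<dots> = h * g p G (L G)"
  proof -
    \<comment> \<open>Homogeneity is available in the first slot only; symmetry carries it to the
      second, which requires the scaled vector itself to be tangent at \<open>p\<close>.\<close>
    have metric: "\<And>X Y r. X \<in> tangent_space M p \<Longrightarrow> Y \<in> tangent_space M p \<Longrightarrow>
        g p (r *\<^sub>R X) Y = r * g p X Y \<and> g p X Y = g p Y X"
      using assms(1) p unfolding riemannian_manifold_def riemannian_metric_def by blast
    have LG: "L G \<in> tangent_space M p"
      using assms(5,9,10) G
      unfolding continuous_pullback_tensor_def tangent_endo_def p_def L_def by blast
    moreover have "h *\<^sub>R L G \<in> tangent_space M p"
      using assms(1) LG by (simp add: riemannian_manifold_def tangent_space_scaleR)
    ultimately show ?thesis
      using G metric by metis
  qed
  also have "g p G (L G) = 0"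
    using assms(6)[OF assms(9,10)] G unfolding skew_symmetric_at_def p_def L_def by blast
  finally show ?thesis by simp
qed

end
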